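(* For every $k\geq1$, the Boolean algebra of languages $\mathcal B\Sigma_1[\mathcal N^u_k]$ is equal to $\mathcal B_k$.
   Context: $A$ is a finite alphabet. A $k$-ary uniform numerical predicate is given by a subset $P\subseteq\mathbb N^k$; a structure $(w,\bar i)$ (a word $w\in A^*$ with positions $\bar i$ marked, all $<|w|$) satisfies it iff $\bar i\in P$. Letter predicates $a(x)$ hold iff the letter at position $x$ is $a$. $\mathcal B\Sigma_1[\mathcal N^u_k]$ is the Boolean algebra of languages $\{w\in A^*: w\models\varphi\}$ defined by Boolean combinations $\varphi$ of sentences of the form $\exists x_1\dots\exists x_m\,\psi$ with $m\leq k$ and $\psi$ quantifier-free, built from letter predicates and uniform numerical predicates of arity $l\in\{1,\dots,k\}$. For $k\geq1$, $\bar a\in A^k$, $w\in A^*$: $c_{\bar a}(w):=\{\bar i\in\mathbb N^k: i_j<|w| \text{ and } w_{i_j}=a_j\text{ for all }j\}$; for $Q\subseteq\mathbb N^k$, $L_{\Diamond^{\bar a}_Q}:=\{w: c_{\bar a}(w)\cap Q\neq\emptyset\}$; $\mathcal B_k$ is the Boolean subalgebra of $\mathcal P(A^* )$ generated by all $L_{\Diamond^{\bar a}_Q}$. *)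

theory Defs
  imports "HOL-Analysis.Sigma_Algebra"
begin

text \<open>Tuples of natural numbers are lists of the appropriate length; positions in a word
  and components of a tuple are counted from 0.\<close>

definition tuples :: "nat \<Rightarrow> nat list set" where
  "tuples l = {is. length is = l}"

datatype (atoms: 'p) bool_comb =
    Atom 'p
  | Tru
  | Neg "'p bool_comb"
  | Conj "'p bool_comb" "'p bool_comb"
  | Disj "'p bool_comb" "'p bool_comb"

primrec holds :: "('p \<Rightarrow> bool) \<Rightarrow> 'p bool_comb \<Rightarrow> bool" where
  "holds v (Atom p) = v p"
| "holds v Tru = True"
| "holds v (Neg \<phi>) = (\<not> holds v \<phi>)"
| "holds v (Conj \<phi> \<psi>) = (holds v \<phi> \<and> holds v \<psi>)"
| "holds v (Disj \<phi> \<psi>) = (holds v \<phi> \<or> holds v \<psi>)"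

text \<open>First-order variables are natural numbers. \<open>Num P xs\<close> applies the uniform numerical
  predicate given by the set \<open>P\<close>, of arity \<open>length xs\<close>, to the variables \<open>xs\<close>;
  \<open>Exists m \<psi>\<close> quantifies the variables \<open>0, \<dots>, m - 1\<close>.\<close>

datatype 'a atomic = Letter 'a nat | Num "nat list set" "nat list"

type_synonym 'a qf = "'a atomic bool_comb"

datatype 'a ex_sentence = Exists nat "'a qf"

primrec wf_atomic :: "'a set \<Rightarrow> nat \<Rightarrow> nat \<Rightarrow> 'a atomic \<Rightarrow> bool" where
  "wf_atomic A k m (Letter a x) \<longleftrightarrow> a \<in> A \<and> x < m"
| "wf_atomic A k m (Num P xs) \<longleftrightarrow>
     length xs \<in> {1..k} \<and> P \<subseteq> tuples (length xs) \<and> set xs \<subseteq> {..<m}"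

primrec wf_ex_sentence :: "'a set \<Rightarrow> nat \<Rightarrow> 'a ex_sentence \<Rightarrow> bool" where
  "wf_ex_sentence A k (Exists m \<psi>) \<longleftrightarrow> m \<le> k \<and> (\<forall>p\<in>atoms \<psi>. wf_atomic A k m p)"

text \<open>In the structure \<open>(w, is)\<close> the variable \<open>x\<close> denotes the marked position \<open>is ! x\<close>.\<close>

primrec sat_atomic :: "'a list \<Rightarrow> nat list \<Rightarrow> 'a atomic \<Rightarrow> bool" where
  "sat_atomic w is (Letter a x) \<longleftrightarrow> w ! (is ! x) = a"
| "sat_atomic w is (Num P xs) \<longleftrightarrow> map (\<lambda>x. is ! x) xs \<in> P"

primrec sat_ex_sentence :: "'a list \<Rightarrow> 'a ex_sentence \<Rightarrow> bool" where
  "sat_ex_sentence w (Exists m \<psi>) \<longleftrightarrow>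
     (\<exists>is\<in>tuples m. set is \<subseteq> {..<length w} \<and> holds (sat_atomic w is) \<psi>)"

definition BSigma1 :: "'a set \<Rightarrow> nat \<Rightarrow> 'a list set set" where
  "BSigma1 A k =
     {{w \<in> lists A. holds (sat_ex_sentence w) \<phi>} | \<phi>. \<forall>s\<in>atoms \<phi>. wf_ex_sentence A k s}"

definition content :: "'a list \<Rightarrow> 'a list \<Rightarrow> nat list set" where
  "content as w =
     {is \<in> tuples (length as). \<forall>j<length as. is ! j < length w \<and> w ! (is ! j) = as ! j}"

definition L_diamond :: "'a set \<Rightarrow> 'a list \<Rightarrow> nat list set \<Rightarrow> 'a list set" where
  "L_diamond A as Q = {w \<in> lists A. content as w \<inter> Q \<noteq> {}}"

definition B_alg :: "'a set \<Rightarrow> nat \<Rightarrow> 'a list set set" where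
  "B_alg A k = algebra (lists A) hull
     {L_diamond A as Q | as Q. as \<in> lists A \<and> length as = k \<and> Q \<subseteq> tuples k}"

end

theory Submission imports Defs begin

text \<open>A quantifier-free formula in the variables \<open>0, \<dots>, m - 1\<close>, evaluated at marked positions
  \<open>is\<close>, depends only on \<open>is\<close> and on the letters read there. Splitting an existential sentence
  according to the finitely many possible tuples of letters, and padding the tuples to length
  \<open>k\<close> by repeating a position, therefore writes its language as a finite union of languages
  \<open>L_diamond\<close>. Conversely, \<open>L_diamond\<close> is literally defined by an existential sentence with \<open>k\<close>
  quantifiers.\<close>

lemma holds_cong:
  "(\<And>p. p \<in> atoms \<phi> \<Longrightarrow> u p = v p) \<Longrightarrow> holds u \<phi> = holds v \<phi>"
  by (induction \<phi>) auto

lemma holds_foldr_Conj: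
  "holds v (foldr Conj \<phi>s \<phi>) \<longleftrightarrow> (\<forall>\<psi>\<in>set \<phi>s. holds v \<psi>) \<and> holds v \<phi>"
  by (induction \<phi>s) auto

lemma atoms_foldr_Conj:
  "atoms (foldr Conj \<phi>s \<phi>) = (\<Union>\<psi>\<in>set \<phi>s. atoms \<psi>) \<union> atoms \<phi>"
  by (induction \<phi>s) auto

text \<open>The second conjunct determines \<open>as\<close> from \<open>w\<close> and
  \<open>is\<close>, so every tuple of positions inside \<open>w\<close> lies in the content of
  exactly one letter tuple. This makes the case split over letter tuples exhaustive.\<close>

lemma content_iff:
  "is \<in> content as w \<longleftrightarrow> set is \<subseteq> {..<length w} \<and> map ((!) w) is = as"
  unfolding content_def tuples_def list_eq_iff_nth_eq subset_eq all_set_conv_all_nth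
  by auto

lemma algebra_BSigma1: "algebra (lists A) (BSigma1 A k)"
  unfolding algebra_iff_Un
proof (intro conjI ballI)
  show "BSigma1 A k \<subseteq> Pow (lists A)"
    by (auto simp: BSigma1_def)
  show "{} \<in> BSigma1 A k"
    unfolding BSigma1_def by (intro CollectI exI[of _ "Neg Tru"]) simp
next
  fix X assume "X \<in> BSigma1 A k"
  then obtain \<phi> where "X = {w \<in> lists A. holds (sat_ex_sentence w) \<phi>}"
    and "\<forall>s\<in>atoms \<phi>. wf_ex_sentence A k s"
    by (auto simp: BSigma1_def)
  then show "lists A - X \<in> BSigma1 A k"
    unfolding BSigma1_def by (intro CollectI exI[of _ "Neg \<phi>"]) auto
next
  fix X Y assume "X \<in> BSigma1 A k" "Y \<in> BSigma1 A k"
  then obtain \<phi> \<psi> where "X = {w \<in> lists A. holds (sat_ex_sentence w) \<phi>}"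
    and "Y = {w \<in> lists A. holds (sat_ex_sentence w) \<psi>}"
    and "\<forall>s\<in>atoms \<phi> \<union> atoms \<psi>. wf_ex_sentence A k s"
    by (auto simp: BSigma1_def)
  then show "X \<union> Y \<in> BSigma1 A k"
    unfolding BSigma1_def by (intro CollectI exI[of _ "Disj \<phi> \<psi>"]) auto
qed

lemma L_diamond_in_BSigma1:
  assumes "as \<in> lists A" and "length as = k" and "Q \<subseteq> tuples k" and "k \<ge> 1"
  shows "L_diamond A as Q \<in> BSigma1 A k"
proof -
  \<comment> \<open>Variable \<open>j\<close> stands for the \<open>j\<close>-th marked position, so
    \<open>Num Q [0..<k]\<close> tests the whole tuple; its arity \<open>k\<close> is admissible
    because \<open>k \<ge> 1\<close>.\<close>
  define \<psi> where "\<psi> =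
    foldr Conj (map (\<lambda>j. Atom (Letter (as ! j) j)) [0..<k]) (Atom (Num Q [0..<k]))"
  have wf: "wf_ex_sentence A k (Exists k \<psi>)"
    using assms by (auto simp: \<psi>_def atoms_foldr_Conj)
  have "sat_ex_sentence w (Exists k \<psi>) \<longleftrightarrow> content as w \<inter> Q \<noteq> {}" for w
  proof -
    have "holds (sat_atomic w is) \<psi> \<longleftrightarrow> map ((!) w) is = as \<and> is \<in> Q" if "is \<in> tuples k" for "is"
    proof -
      have "map ((!) is) [0..<k] = is"
        using that map_nth[of "is"] by (simp add: tuples_def)
      then have "holds (sat_atomic w is) \<psi> \<longleftrightarrow> (\<forall>j<k. w ! (is ! j) = as ! j) \<and> is \<in> Q"
        by (auto simp: \<psi>_def holds_foldr_Conj)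
      then show ?thesis
        using that assms(2) by (simp add: list_eq_iff_nth_eq tuples_def)
    qed
    then show ?thesis
      using assms(3) by (auto simp: content_iff)
  qed
  then have "L_diamond A as Q = {w \<in> lists A. holds (sat_ex_sentence w) (Atom (Exists k \<psi>))}"
    by (simp add: L_diamond_def)
  with wf show ?thesis
    unfolding BSigma1_def by (intro CollectI exI[of _ "Atom (Exists k \<psi>)"]) simp
qed

lemma ex_sentence_eq_Union_L_diamond:
  assumes "wf_ex_sentence A k (Exists m \<psi>)" and "m \<ge> 1"
  obtains Q where "\<And>as. Q as \<subseteq> tuples k"
    and "{w \<in> lists A. sat_ex_sentence w (Exists m \<psi>)} =
      (\<Union>as\<in>{as \<in> lists A. length as = k}. L_diamond A as (Q as))"
proof
  \<comment> \<open>The valuation \<open>v\<close> reads letters from \<open>as\<close> instead of a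
    word, so \<open>Q as\<close> can be fixed before any \<open>w\<close> is given.\<close>
  define v where "v as is = (\<lambda>p. case p of
    Letter a x \<Rightarrow> as ! x = a | Num P xs \<Rightarrow> map ((!) is) xs \<in> P)" for as :: "'a list" and "is"
  define Q where "Q as = {is \<in> tuples k. holds (v as is) \<psi>}" for as
  have "m \<le> k" and wf: "\<And>p. p \<in> atoms \<psi> \<Longrightarrow> wf_atomic A k m p"
    using assms(1) by auto
  \<comment> \<open>Only variables below \<open>m\<close> occur in \<open>\<psi>\<close>, so the
    entries \<open>ks\<close> after \<open>is\<close> cannot affect its value.\<close>
  have eval: "holds (v (map ((!) w) js) js) \<psi> \<longleftrightarrow> holds (sat_atomic w is) \<psi>"
    if "js = is @ ks" "length is = m" for w "is" js ks
  proof (rule holds_cong)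
    fix p assume "p \<in> atoms \<psi>"
    from wf[OF this] show "v (map ((!) w) js) js p = sat_atomic w is p"
    proof (cases p)
      case (Num P xs)
      with wf[OF \<open>p \<in> atoms \<psi>\<close>] have "map ((!) js) xs = map ((!) is) xs"
        using that by (auto simp: nth_append)
      with Num show ?thesis by (simp add: v_def del: map_eq_conv)
    qed (use that in \<open>auto simp: v_def nth_append\<close>)
  qed
  show "Q as \<subseteq> tuples k" for as
    by (auto simp: Q_def)
  show "{w \<in> lists A. sat_ex_sentence w (Exists m \<psi>)} =
      (\<Union>as\<in>{as \<in> lists A. length as = k}. L_diamond A as (Q as))" (is "?L = ?R")
  proof (intro equalityI subsetI)
    fix w assume "w \<in> ?L"
    then obtain "is" where "is": "w \<in> lists A" "length is = m" "set is \<subseteq> {..<length w}"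
      "holds (sat_atomic w is) \<psi>"
      by (auto simp: tuples_def)
    \<comment> \<open>The padding has to consist of positions inside \<open>w\<close>;
      \<open>is ! 0\<close> is one, and it exists because \<open>m \<ge> 1\<close>.\<close>
    define js where "js = is @ replicate (k - m) (is ! 0)"
    have "is ! 0 \<in> set is"
      using "is"(2) assms(2) by (intro nth_mem) simp
    then have js: "set js \<subseteq> {..<length w}" "length js = k"
      using "is" \<open>m \<le> k\<close> by (auto simp: js_def)
    have "map ((!) w) js \<in> lists A"
      using js(1) "is"(1) by (auto simp: lists_eq_set subset_iff)
    moreover have "js \<in> content (map ((!) w) js) w" "js \<in> Q (map ((!) w) js)"
      using js "is" eval[OF js_def] by (auto simp: content_iff Q_def tuples_def)
    then have "w \<in> L_diamond A (map ((!) w) js) (Q (map ((!) w) js))"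
      unfolding L_diamond_def using "is"(1) by blast
    ultimately show "w \<in> ?R"
      using js(2) by (intro UN_I[of "map ((!) w) js"]) simp_all
  next
    fix w assume "w \<in> ?R"
    then obtain as js where "w \<in> lists A" "js \<in> content as w" "js \<in> Q as"
      unfolding L_diamond_def by blast
    then have js: "w \<in> lists A" "set js \<subseteq> {..<length w}" "length js = k"
      "holds (v (map ((!) w) js) js) \<psi>"
      by (simp_all add: content_iff Q_def tuples_def)
    \<comment> \<open>A member of \<open>Q as\<close> need not end in a repeated position, but its
      first \<open>m\<close> entries already witness the sentence.\<close>
    have "holds (sat_atomic w (take m js)) \<psi>"
      using eval[of js "take m js" "drop m js" w] js \<open>m \<le> k\<close> by simp
    moreover have "set (take m js) \<subseteq> {..<length w}"
      using js(2) set_take_subset[of m js] by blast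
    moreover have "take m js \<in> tuples m"
      using js(3) \<open>m \<le> k\<close> by (simp add: tuples_def)
    ultimately show "w \<in> ?L"
      using js(1) unfolding sat_ex_sentence.simps by blast
  qed
qed

lemma ex_sentence_in_algebra:
  assumes "finite A" and M: "algebra (lists A) M"
    and gen: "\<And>as Q. as \<in> lists A \<Longrightarrow> length as = k \<Longrightarrow> Q \<subseteq> tuples k \<Longrightarrow> L_diamond A as Q \<in> M"
    and wf: "wf_ex_sentence A k s"
  shows "{w \<in> lists A. sat_ex_sentence w s} \<in> M"
proof -
  interpret algebra "lists A" M by (rule M)
  obtain m \<psi> where s: "s = Exists m \<psi>" by (cases s)
  show ?thesis
  proof (cases "m = 0")
    case True
    \<comment> \<open>Arities are positive, so \<open>\<psi>\<close> has no atoms and is constant; the union over letter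
      tuples would miss the empty word.\<close>
    have "\<not> wf_atomic A k 0 p" for p
      by (cases p) auto
    then have "atoms \<psi> = {}"
      using wf s True by auto
    then have "holds (sat_atomic w is) \<psi> = holds (sat_atomic [] []) \<psi>" for w "is"
      by (intro holds_cong) simp
    then have "sat_ex_sentence w s \<longleftrightarrow> holds (sat_atomic ([] :: 'a list) []) \<psi>" for w
      using s True by (auto simp: tuples_def)
    then show ?thesis
      by (cases "holds (sat_atomic ([] :: 'a list) []) \<psi>") auto
  next
    case False
    then have "m \<ge> 1" by simp
    from ex_sentence_eq_Union_L_diamond[OF wf[unfolded s] this, folded s]
    obtain Q where Q: "\<And>as. Q as \<subseteq> tuples k"
      and eq: "{w \<in> lists A. sat_ex_sentence w s} =
        (\<Union>as\<in>{as \<in> lists A. length as = k}. L_diamond A as (Q as))"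
      by blast
    \<comment> \<open>Here the finiteness of the alphabet enters: an algebra is closed under finite
      unions only.\<close>
    have "finite {as \<in> lists A. length as = k}"
      using finite_lists_length_eq[OF \<open>finite A\<close>, of k] by (simp add: lists_eq_set)
    then show ?thesis
      unfolding eq using gen Q by (intro finite_UN) auto
  qed
qed

text \<open>\<open>M\<close> is an arbitrary algebra containing the generators because the hull is
  the intersection of all of these; closure under the connectives then reduces everything to single
  existential sentences.\<close>

lemma BSigma1_subset_algebra:
  assumes "finite A" and M: "algebra (lists A) M"
    and gen: "\<And>as Q. as \<in> lists A \<Longrightarrow> length as = k \<Longrightarrow> Q \<subseteq> tuples k \<Longrightarrow> L_diamond A as Q \<in> M"
  shows "BSigma1 A k \<subseteq> M"
proof -
  interpret algebra "lists A" M by (rule M)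
  have "{w \<in> lists A. holds (sat_ex_sentence w) \<phi>} \<in> M"
    if "\<forall>s\<in>atoms \<phi>. wf_ex_sentence A k s" for \<phi>
    using that
  proof (induction \<phi>)
    case (Atom s)
    then show ?case
      using ex_sentence_in_algebra[OF assms(1) M gen] by simp
  qed (auto intro: sets_Collect_neg sets_Collect_conj sets_Collect_disj)
  then show ?thesis
    by (auto simp: BSigma1_def)
qed

theorem mainTheorem3:
  fixes A :: "'a set" and k :: nat
  assumes "finite A" and "k \<ge> 1"
  shows "BSigma1 A k = B_alg A k"
proof
  show "BSigma1 A k \<subseteq> B_alg A k"
    unfolding B_alg_def hull_def
    by (intro Inter_greatest BSigma1_subset_algebra[OF assms(1)]) blast+
  show "B_alg A k \<subseteq> BSigma1 A k"
    unfolding B_alg_def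
  proof (rule hull_minimal)
    show "{L_diamond A as Q | as Q. as \<in> lists A \<and> length as = k \<and> Q \<subseteq> tuples k}
        \<subseteq> BSigma1 A k"
    proof
      fix X assume "X \<in> {L_diamond A as Q | as Q. as \<in> lists A \<and> length as = k \<and> Q \<subseteq> tuples k}"
      then obtain as Q where "X = L_diamond A as Q" "as \<in> lists A" "length as = k" "Q \<subseteq> tuples k"
        by blast
      then show "X \<in> BSigma1 A k"
        using L_diamond_in_BSigma1 assms(2) by metis
    qed
  qed (rule algebra_BSigma1)
qed

end
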